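(* Let $\langle X,\tau,\le,\eta_1,\eta_2,C\rangle$ be an MNE-space and let $\epsilon_X\colon X\to X(\mathcal{U}(X))$ be defined by $\epsilon_X(x)=\{U\in\mathcal{U}(X): x\in U\}$. Then $\epsilon_X$ is an ME-homeomorphism (a homeomorphism and order isomorphism onto $X(\mathcal{U}(X))$ satisfying $\eta_{\Box_{\eta_1}}(\epsilon_X(x))=\{\epsilon_X[U]: U\in\eta_1(x)\}$ and $\eta_{\Diamond_{\eta_2}}(\epsilon_X(x))=\{\epsilon_X[D]: D\in\eta_2(x)\}$ for all $x$) that satisfies $\epsilon_X[C]=\mathcal{C}(F_C)$, where $F_C=\{U\in\mathcal{U}(X): C\subseteq U\}$ and $\mathcal{C}(F_C)=\{P\in X(\mathcal{U}(X)): F_C\subseteq P\}$.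
   Context: An Esakia space is a compact ordered space $\langle X,\tau,\le\rangle$ such that if $x\not\le y$ there is a clopen up-set containing $x$ but not $y$, and ${\downarrow}U$ is clopen for every clopen $U$; $\mathcal{U}(X)$, $\mathcal{D}(X)$ denote clopen up-/down-sets, and $\mathcal{U}(X)$ is a Heyting algebra. A modal Esakia space is $\langle X,\tau,\le,\eta_1,\eta_2\rangle$ with $\eta_1,\eta_2\colon X\to\mathcal{P}(\mathcal{P}(X))$ such that for all $x$, $U,V\in\mathcal{U}(X)$: $\eta_1(x)\subseteq\mathcal{U}(X)$, $\eta_2(x)\subseteq\mathcal{D}(X)$; $\Box_{\eta_1}(U)=\{x: U\in\eta_1(x)\}$ and $\Diamond_{\eta_2}(U)=\{x: X\setminus U\notin\eta_2(x)\}$ are clopen up-sets; if $U\in\eta_1(x)$ then ${\downarrow}U\cup(X\setminus V)\in\eta_2(x)$. An MNE-space adds a closed subset $C$ of the set $\max(X)$ of maximal elements such that for all $U,V\in\mathcal{U}(X)$: if $C\subseteq U\cup V$ and $U\cap V=\emptyset$ then $C\subseteq\Box_{\eta_1}(U)\cup\Diamond_{\eta_2}(V)$. For a modal Heyting algebra $\langle\mathbf{H},\Box,\Diamond\rangle$ (here $\mathbf{H}=\mathcal{U}(X)$, $\Box=\Box_{\eta_1}$, $\Diamond=\Diamond_{\eta_2}$): $X(\mathbf{H})$ is the set of prime filters ordered by inclusion with topology generated by $\sigma_{\mathbf{H}}(a)=\{P: a\in P\}$ and their complements, $\eta_\Box(P)=\{\sigma_{\mathbf{H}}(a): \Box a\in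 P\}$, $\eta_\Diamond(P)=\mathcal{D}(X(\mathbf{H}))\setminus\{X(\mathbf{H})\setminus\sigma_{\mathbf{H}}(a): \Diamond a\in P\}$. *)

theory Defs
  imports "HOL-Analysis.Abstract_Topology" "HOL-Algebra.Lattice"
begin

text \<open>
  A space is given by an abstract topology \<open>X\<close>, whose carrier is \<open>topspace X\<close>, and an order
  relation \<open>r\<close> on that carrier, where \<open>(x, y) \<in> r\<close> means \<open>x \<le> y\<close>. Thus \<open>r `` U\<close> is the up-set
  and \<open>r\<inverse> `` U\<close> the down-set generated by \<open>U\<close>.
\<close>

definition clopen_upsets :: "'a topology \<Rightarrow> 'a rel \<Rightarrow> 'a set set" where
  "clopen_upsets X r = {U. openin X U \<and> closedin X U \<and> r `` U \<subseteq> U}"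

definition clopen_downsets :: "'a topology \<Rightarrow> 'a rel \<Rightarrow> 'a set set" where
  "clopen_downsets X r = {U. openin X U \<and> closedin X U \<and> r\<inverse> `` U \<subseteq> U}"

definition max_elements :: "'a topology \<Rightarrow> 'a rel \<Rightarrow> 'a set" where
  "max_elements X r = {x \<in> topspace X. \<forall>y. (x, y) \<in> r \<longrightarrow> y = x}"

definition box_of :: "'a topology \<Rightarrow> ('a \<Rightarrow> 'a set set) \<Rightarrow> 'a set \<Rightarrow> 'a set" where
  "box_of X \<eta> U = {x \<in> topspace X. U \<in> \<eta> x}"

definition diamond_of :: "'a topology \<Rightarrow> ('a \<Rightarrow> 'a set set) \<Rightarrow> 'a set \<Rightarrow> 'a set" where
  "diamond_of X \<eta> U = {x \<in> topspace X. topspace X - U \<notin> \<eta> x}"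

text \<open>
  No separate assumption that the order is closed in the product is made: it follows from
  \<open>separation\<close>.
\<close>

locale esakia_space =
  fixes X :: "'a topology" and r :: "'a rel"
  assumes compact: "compact_space X"
    and partial_order: "partial_order_on (topspace X) r"
    and separation: "\<lbrakk>x \<in> topspace X; y \<in> topspace X; (x, y) \<notin> r\<rbrakk>
      \<Longrightarrow> \<exists>U \<in> clopen_upsets X r. x \<in> U \<and> y \<notin> U"
    and clopen_down_closure: "\<lbrakk>openin X U; closedin X U\<rbrakk>
      \<Longrightarrow> openin X (r\<inverse> `` U) \<and> closedin X (r\<inverse> `` U)"

locale modal_esakia_space = esakia_space X r
  for X :: "'a topology" and r :: "'a rel" +
  fixes \<eta>\<^sub>1 \<eta>\<^sub>2 :: "'a \<Rightarrow> 'a set set"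
  assumes eta1_subset: "x \<in> topspace X \<Longrightarrow> \<eta>\<^sub>1 x \<subseteq> clopen_upsets X r"
    and eta2_subset: "x \<in> topspace X \<Longrightarrow> \<eta>\<^sub>2 x \<subseteq> clopen_downsets X r"
    and box_closed: "U \<in> clopen_upsets X r \<Longrightarrow> box_of X \<eta>\<^sub>1 U \<in> clopen_upsets X r"
    and diamond_closed: "U \<in> clopen_upsets X r \<Longrightarrow> diamond_of X \<eta>\<^sub>2 U \<in> clopen_upsets X r"
    and eta1_eta2: "\<lbrakk>x \<in> topspace X; U \<in> clopen_upsets X r; V \<in> clopen_upsets X r; U \<in> \<eta>\<^sub>1 x\<rbrakk>
      \<Longrightarrow> r\<inverse> `` U \<union> (topspace X - V) \<in> \<eta>\<^sub>2 x"

locale mne_space = modal_esakia_space X r \<eta>\<^sub>1 \<eta>\<^sub>2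
  for X :: "'a topology" and r :: "'a rel" and \<eta>\<^sub>1 \<eta>\<^sub>2 :: "'a \<Rightarrow> 'a set set" +
  fixes C :: "'a set"
  assumes C_closed: "closedin X C"
    and C_max: "C \<subseteq> max_elements X r"
    and C_cover: "\<lbrakk>U \<in> clopen_upsets X r; V \<in> clopen_upsets X r; C \<subseteq> U \<union> V; U \<inter> V = {}\<rbrakk>
      \<Longrightarrow> C \<subseteq> box_of X \<eta>\<^sub>1 U \<union> diamond_of X \<eta>\<^sub>2 V"

text \<open>
  A Heyting algebra is determined by its order, so a modal Heyting algebra is represented by an
  order record extended with the two modal operators; meets and joins are those of
  \<^theory>\<open>HOL-Algebra.Lattice\<close>.
\<close>

record 'a modal_order = "'a gorder" +
  Box :: "'a \<Rightarrow> 'a"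
  Diamond :: "'a \<Rightarrow> 'a"

locale heyting_algebra = bounded_lattice L for L (structure) +
  assumes implication_exists: "\<lbrakk>a \<in> carrier L; b \<in> carrier L\<rbrakk>
    \<Longrightarrow> \<exists>c \<in> carrier L. \<forall>x \<in> carrier L. x \<sqinter> a \<sqsubseteq> b \<longleftrightarrow> x \<sqsubseteq> c"

definition prime_filters :: "('a, 'b) gorder_scheme \<Rightarrow> 'a set set" where
  "prime_filters H = {P. P \<subseteq> carrier H \<and> P \<noteq> {} \<and> P \<noteq> carrier H
    \<and> (\<forall>a \<in> P. \<forall>b \<in> carrier H. a \<sqsubseteq>\<^bsub>H\<^esub> b \<longrightarrow> b \<in> P)
    \<and> (\<forall>a \<in> P. \<forall>b \<in> P. a \<sqinter>\<^bsub>H\<^esub> b \<in> P)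
    \<and> (\<forall>a \<in> carrier H. \<forall>b \<in> carrier H. a \<squnion>\<^bsub>H\<^esub> b \<in> P \<longrightarrow> a \<in> P \<or> b \<in> P)}"

definition stone_map :: "('a, 'b) gorder_scheme \<Rightarrow> 'a \<Rightarrow> 'a set set" where
  "stone_map H a = {P \<in> prime_filters H. a \<in> P}"

definition dual_topology :: "('a, 'b) gorder_scheme \<Rightarrow> 'a set topology" where
  "dual_topology H = topology_generated_by
    (stone_map H ` carrier H \<union> (\<lambda>a. prime_filters H - stone_map H a) ` carrier H)"

definition dual_order :: "('a, 'b) gorder_scheme \<Rightarrow> 'a set rel" where
  "dual_order H = {(P, Q). P \<in> prime_filters H \<and> Q \<in> prime_filters H \<and> P \<subseteq> Q}"

definition dual_eta_box :: "'a modal_order \<Rightarrow> 'a set \<Rightarrow> 'a set set set" where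
  "dual_eta_box H P = {stone_map H a | a. a \<in> carrier H \<and> Box H a \<in> P}"

definition dual_eta_diamond :: "'a modal_order \<Rightarrow> 'a set \<Rightarrow> 'a set set set" where
  "dual_eta_diamond H P = clopen_downsets (dual_topology H) (dual_order H)
    - {prime_filters H - stone_map H a | a. a \<in> carrier H \<and> Diamond H a \<in> P}"

definition closed_of_filter :: "('a, 'b) gorder_scheme \<Rightarrow> 'a set \<Rightarrow> 'a set set" where
  "closed_of_filter H F = {P \<in> prime_filters H. F \<subseteq> P}"

definition upset_algebra ::
  "'a topology \<Rightarrow> 'a rel \<Rightarrow> ('a \<Rightarrow> 'a set set) \<Rightarrow> ('a \<Rightarrow> 'a set set) \<Rightarrow> 'a set modal_order" where
  "upset_algebra X r \<eta>\<^sub>1 \<eta>\<^sub>2 =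
    \<lparr>carrier = clopen_upsets X r, eq = (=), le = (\<subseteq>),
     Box = box_of X \<eta>\<^sub>1, Diamond = diamond_of X \<eta>\<^sub>2\<rparr>"

definition filter_of_closed :: "'a topology \<Rightarrow> 'a rel \<Rightarrow> 'a set \<Rightarrow> 'a set set" where
  "filter_of_closed X r C = {U \<in> clopen_upsets X r. C \<subseteq> U}"

definition epsilon :: "'a topology \<Rightarrow> 'a rel \<Rightarrow> 'a \<Rightarrow> 'a set set" where
  "epsilon X r x = {U \<in> clopen_upsets X r. x \<in> U}"

definition me_homeomorphism ::
  "'a topology \<Rightarrow> 'a rel \<Rightarrow> ('a \<Rightarrow> 'a set set) \<Rightarrow> ('a \<Rightarrow> 'a set set) \<Rightarrow>
   'b topology \<Rightarrow> 'b rel \<Rightarrow> ('b \<Rightarrow> 'b set set) \<Rightarrow> ('b \<Rightarrow> 'b set set) \<Rightarrow> ('a \<Rightarrow> 'b) \<Rightarrow> bool" where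
  "me_homeomorphism X r \<eta>\<^sub>1 \<eta>\<^sub>2 Y s \<theta>\<^sub>1 \<theta>\<^sub>2 f \<longleftrightarrow>
    homeomorphic_map X Y f
    \<and> (\<forall>x \<in> topspace X. \<forall>y \<in> topspace X. (x, y) \<in> r \<longleftrightarrow> (f x, f y) \<in> s)
    \<and> (\<forall>x \<in> topspace X. \<theta>\<^sub>1 (f x) = {f ` U | U. U \<in> \<eta>\<^sub>1 x} \<and> \<theta>\<^sub>2 (f x) = {f ` D | D. D \<in> \<eta>\<^sub>2 x})"

lemma topspace_dual_topology:
  assumes "carrier H \<noteq> {}"
  shows "topspace (dual_topology H) = prime_filters H"
  using assms unfolding dual_topology_def topology_generated_by_topspace
  by (auto simp: stone_map_def)

context esakia_space
begin

lemma upset_algebra_Int_Un: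
  assumes "U \<in> clopen_upsets X r" "V \<in> clopen_upsets X r"
  shows "U \<inter> V \<in> clopen_upsets X r" "U \<union> V \<in> clopen_upsets X r"
  using assms
  by (simp_all add: clopen_upsets_def openin_Int closedin_Int openin_Un closedin_Un Image_Un, blast+)

lemma greatest_Int:
  assumes "U \<in> clopen_upsets X r" "V \<in> clopen_upsets X r"
  shows "greatest (upset_algebra X r \<eta>\<^sub>1 \<eta>\<^sub>2) W (Lower (upset_algebra X r \<eta>\<^sub>1 \<eta>\<^sub>2) {U, V})
    \<longleftrightarrow> W = U \<inter> V"
proof -
  have "Lower (upset_algebra X r \<eta>\<^sub>1 \<eta>\<^sub>2) {U, V} = {Z \<in> clopen_upsets X r. Z \<subseteq> U \<inter> V}"
    using assms by (simp add: Lower_def upset_algebra_def) blast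
  then show ?thesis
    using upset_algebra_Int_Un(1)[OF assms] by (simp add: greatest_def upset_algebra_def) blast
qed

lemma least_Un:
  assumes "U \<in> clopen_upsets X r" "V \<in> clopen_upsets X r"
  shows "least (upset_algebra X r \<eta>\<^sub>1 \<eta>\<^sub>2) W (Upper (upset_algebra X r \<eta>\<^sub>1 \<eta>\<^sub>2) {U, V})
    \<longleftrightarrow> W = U \<union> V"
proof -
  have "Upper (upset_algebra X r \<eta>\<^sub>1 \<eta>\<^sub>2) {U, V} = {Z \<in> clopen_upsets X r. U \<union> V \<subseteq> Z}"
    using assms by (simp add: Upper_def upset_algebra_def) blast
  then show ?thesis
    using upset_algebra_Int_Un(2)[OF assms] by (simp add: least_def upset_algebra_def) blast
qed

lemma meet_upset_algebra:
  assumes "U \<in> clopen_upsets X r" "V \<in> clopen_upsets X r"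
  shows "U \<sqinter>\<^bsub>upset_algebra X r \<eta>\<^sub>1 \<eta>\<^sub>2\<^esub> V = U \<inter> V"
  unfolding meet_def inf_def greatest_Int[OF assms] by simp

lemma join_upset_algebra:
  assumes "U \<in> clopen_upsets X r" "V \<in> clopen_upsets X r"
  shows "U \<squnion>\<^bsub>upset_algebra X r \<eta>\<^sub>1 \<eta>\<^sub>2\<^esub> V = U \<union> V"
  unfolding join_def sup_def least_Un[OF assms] by simp

lemma heyting_algebra_upset_algebra: "heyting_algebra (upset_algebra X r \<eta>\<^sub>1 \<eta>\<^sub>2)"
proof -
  let ?H = "upset_algebra X r \<eta>\<^sub>1 \<eta>\<^sub>2"
  have r: "r \<subseteq> topspace X \<times> topspace X" "refl_on (topspace X) r" "trans r"
    using partial_order by (simp_all add: partial_order_on_def preorder_on_def)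
  have carrier: "carrier ?H = clopen_upsets X r" and le: "le ?H = (\<subseteq>)" and eq: "eq ?H = (=)"
    by (simp_all add: upset_algebra_def)
  have subset: "U \<subseteq> topspace X" if "U \<in> clopen_upsets X r" for U
    using that by (simp add: clopen_upsets_def openin_subset)
  have "r `` topspace X \<subseteq> topspace X"
    using r(1) by blast
  then have top: "topspace X \<in> clopen_upsets X r" and bot: "{} \<in> clopen_upsets X r"
    by (simp_all add: clopen_upsets_def)
  have po: "partial_order ?H"
    by unfold_locales (simp_all add: carrier le eq)
  have lat: "bounded_lattice ?H"
  proof (intro bounded_lattice.intro lattice.intro upper_semilattice.intro lower_semilattice.intro
      weak_partial_order_bottom.intro weak_partial_order_top.intro po
      partial_order.axioms(1)[OF po] upper_semilattice_axioms.intro lower_semilattice_axioms.intro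
      weak_partial_order_bottom_axioms.intro weak_partial_order_top_axioms.intro)
    fix U V assume UV: "U \<in> carrier ?H" "V \<in> carrier ?H"
    show "\<exists>s. least ?H s (Upper ?H {U, V})"
      using UV least_Un[of U V] by (simp add: carrier)
    show "\<exists>s. greatest ?H s (Lower ?H {U, V})"
      using UV greatest_Int[of U V] by (simp add: carrier)
  next
    have "least ?H {} (carrier ?H)"
      using bot by (simp add: least_def carrier le)
    then show "\<exists>x. least ?H x (carrier ?H)" ..
    have "greatest ?H (topspace X) (carrier ?H)"
      using top subset by (simp add: greatest_def carrier le)
    then show "\<exists>x. greatest ?H x (carrier ?H)" ..
  qed
  have "\<exists>c \<in> carrier ?H. \<forall>x \<in> carrier ?H. x \<sqinter>\<^bsub>?H\<^esub> U \<sqsubseteq>\<^bsub>?H\<^esub> V \<longleftrightarrow> x \<sqsubseteq>\<^bsub>?H\<^esub> c"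
    if "U \<in> carrier ?H" "V \<in> carrier ?H" for U V
  proof -
    have UV: "U \<in> clopen_upsets X r" "V \<in> clopen_upsets X r"
      using that by (simp_all add: carrier)
    define W where "W = topspace X - r\<inverse> `` (U - V)"
    have "openin X (U - V)" "closedin X (U - V)"
      using UV by (simp_all add: clopen_upsets_def openin_diff closedin_diff)
    then have "openin X W" "closedin X W"
      using clopen_down_closure[of "U - V"] by (simp_all add: W_def openin_diff closedin_diff)
    moreover have "y \<in> W" if "x \<in> W" "(x, y) \<in> r" for x y
    proof -
      have "y \<in> topspace X"
        using that r(1) by blast
      moreover have "y \<notin> r\<inverse> `` (U - V)"
        using that transD[OF r(3) \<open>(x, y) \<in> r\<close>] by (simp add: W_def Image_iff) blast
      ultimately show ?thesis
        by (simp add: W_def)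
    qed
    ultimately have W: "W \<in> clopen_upsets X r"
      unfolding clopen_upsets_def by blast
    have Z: "Z \<inter> U \<subseteq> V \<longleftrightarrow> Z \<subseteq> W" if "Z \<in> clopen_upsets X r" for Z
    proof
      assume "Z \<inter> U \<subseteq> V"
      moreover have "y \<in> Z" if "x \<in> Z" "(x, y) \<in> r" for x y
        using that \<open>Z \<in> clopen_upsets X r\<close> unfolding clopen_upsets_def by blast
      ultimately show "Z \<subseteq> W"
        using subset[OF that] unfolding W_def by blast
    next
      assume "Z \<subseteq> W"
      moreover have "x \<notin> W" if "x \<in> U - V" for x
        using that subset[OF UV(1)] r(2) unfolding W_def refl_on_def by blast
      ultimately show "Z \<inter> U \<subseteq> V"
        by blast
    qed
    show ?thesis
      using W UV by (intro bexI[of _ W]) (simp_all add: carrier le meet_upset_algebra Z)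
  qed
  with lat show ?thesis
    by (simp add: heyting_algebra_def heyting_algebra_axioms_def)
qed

end

end

theory Submission
  imports Defs "HOL-Analysis.T1_Spaces"
begin

text \<open>
  By separation, \<open>\<epsilon>\<close> is an order embedding, and every prime filter \<open>P\<close> is some \<open>\<epsilon>(x)\<close>: otherwise
  the complements of the members of \<open>P\<close> and the clopen up-sets outside \<open>P\<close> cover the space, and a
  finite subcover contradicts primality. Hence the Stone map sends \<open>U\<close> to \<open>\<epsilon>[U]\<close>, so \<open>\<epsilon>\<close> is a
  continuous bijection from a compact space onto a Hausdorff space, and the clauses on neighbourhood
  functions follow by transport. Since \<open>C\<close> consists of maximal elements, no \<open>c \<in> C\<close> lies below a
  point \<open>x \<notin> C\<close>, so by compactness some clopen up-set contains \<open>C\<close> but not \<open>x\<close>.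
\<close>

section \<open>Compactness for union-closed properties, and the Hausdorff property of the
  dual\<close>

lemma compactin_open_cover_directed:
  assumes "compactin X S"
    and cover: "\<And>x. x \<in> S \<Longrightarrow> \<exists>W. openin X W \<and> x \<in> W \<and> Q W"
    and empty: "Q {}"
    and Un: "\<And>V W. Q V \<Longrightarrow> Q W \<Longrightarrow> Q (V \<union> W)"
  shows "\<exists>W. S \<subseteq> W \<and> Q W"
proof -
  have "S \<subseteq> \<Union>{W. openin X W \<and> Q W}"
    using cover by blast
  then obtain \<F> where \<F>: "finite \<F>" "\<F> \<subseteq> {W. openin X W \<and> Q W}" "S \<subseteq> \<Union>\<F>"
    using compactinD[OF assms(1), of "{W. openin X W \<and> Q W}"] by blast
  \<comment> \<open>Closure of \<open>Q\<close> under unions merges the finite subcover into one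
    set. The conclusion does not mention openness, so \<open>Q\<close> itself has to carry whatever
    is wanted of that set.\<close>
  from \<F>(1,2) have "Q (\<Union>\<F>)"
    by (induction rule: finite_induct) (simp_all add: empty Un)
  with \<F>(3) show ?thesis
    by blast
qed

text \<open>Distinct prime filters differ in some element \<open>a\<close>. The Stone set of
  \<open>a\<close> and its complement are both subbasic open sets, and they separate the two
  filters.\<close>

lemma Hausdorff_dual_topology:
  assumes "carrier H \<noteq> {}"
  shows "Hausdorff_space (dual_topology H)"
  unfolding Hausdorff_space_def
proof (intro allI impI)
  fix P Q assume PQ: "P \<in> topspace (dual_topology H) \<and> Q \<in> topspace (dual_topology H) \<and> P \<noteq> Q"
  then have pf: "P \<in> prime_filters H" "Q \<in> prime_filters H" "P \<noteq> Q"
    by (simp_all add: topspace_dual_topology[OF assms])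
  then have "P \<subseteq> carrier H" "Q \<subseteq> carrier H"
    by (simp_all add: prime_filters_def)
  with pf(3) obtain a where a: "a \<in> carrier H" "a \<in> P \<longleftrightarrow> a \<notin> Q"
    by blast
  have "openin (dual_topology H) (stone_map H a)"
    "openin (dual_topology H) (prime_filters H - stone_map H a)"
    using a(1) unfolding dual_topology_def by (blast intro: topology_generated_by_Basis)+
  moreover have "P \<in> stone_map H a \<and> Q \<in> prime_filters H - stone_map H a
      \<or> Q \<in> stone_map H a \<and> P \<in> prime_filters H - stone_map H a"
    using pf a(2) by (auto simp: stone_map_def)
  ultimately show "\<exists>U V. openin (dual_topology H) U \<and> openin (dual_topology H) V
      \<and> P \<in> U \<and> Q \<in> V \<and> disjnt U V"
    unfolding disjnt_def by blast
qed

section \<open>Clopen up-sets and their prime filters\<close>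

context esakia_space
begin

lemma order_subset: "r \<subseteq> topspace X \<times> topspace X" and antisym_order: "antisym r"
  using partial_order by (simp_all add: partial_order_on_def preorder_on_def)

lemma clopen_upsets_subset: "U \<in> clopen_upsets X r \<Longrightarrow> U \<subseteq> topspace X"
  by (simp add: clopen_upsets_def openin_subset)

lemma empty_in_clopen_upsets: "{} \<in> clopen_upsets X r"
  by (simp add: clopen_upsets_def)

lemma topspace_in_clopen_upsets: "topspace X \<in> clopen_upsets X r"
  using order_subset by (auto simp: clopen_upsets_def)

text \<open>Connects \<open>\<eta>\<^sub>2\<close>, whose values consist of down-sets, with
  \<open>dual_eta_diamond\<close>, which is phrased with complements of Stone sets.\<close>

lemma clopen_downsets_iff:
  "D \<in> clopen_downsets X r \<longleftrightarrow> (\<exists>U \<in> clopen_upsets X r. D = topspace X - U)"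
proof
  assume D: "D \<in> clopen_downsets X r"
  have "topspace X - D \<in> clopen_upsets X r"
    using D order_subset
    by (auto simp: clopen_upsets_def clopen_downsets_def)
  moreover have "D = topspace X - (topspace X - D)"
    using D openin_subset[of X D] by (auto simp: clopen_downsets_def)
  ultimately show "\<exists>U \<in> clopen_upsets X r. D = topspace X - U"
    by blast
next
  assume "\<exists>U \<in> clopen_upsets X r. D = topspace X - U"
  then show "D \<in> clopen_downsets X r"
    using order_subset by (auto simp: clopen_upsets_def clopen_downsets_def)
qed

lemma prime_filters_upset_algebra_iff:
  "P \<in> prime_filters (upset_algebra X r \<eta>\<^sub>1 \<eta>\<^sub>2) \<longleftrightarrow>
    P \<subseteq> clopen_upsets X r \<and> P \<noteq> {} \<and> P \<noteq> clopen_upsets X r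
    \<and> (\<forall>U \<in> P. \<forall>V \<in> clopen_upsets X r. U \<subseteq> V \<longrightarrow> V \<in> P)
    \<and> (\<forall>U \<in> P. \<forall>V \<in> P. U \<inter> V \<in> P)
    \<and> (\<forall>U \<in> clopen_upsets X r. \<forall>V \<in> clopen_upsets X r. U \<union> V \<in> P \<longrightarrow> U \<in> P \<or> V \<in> P)"
proof -
  have "carrier (upset_algebra X r \<eta>\<^sub>1 \<eta>\<^sub>2) = clopen_upsets X r"
    "le (upset_algebra X r \<eta>\<^sub>1 \<eta>\<^sub>2) = (\<subseteq>)"
    by (simp_all add: upset_algebra_def)
  moreover have "U \<sqinter>\<^bsub>upset_algebra X r \<eta>\<^sub>1 \<eta>\<^sub>2\<^esub> V = U \<inter> V"
    if "P \<subseteq> clopen_upsets X r" "U \<in> P" "V \<in> P" for U V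
    using that by (intro meet_upset_algebra) blast+
  \<comment> \<open>The meet and join equations hold only for clopen up-sets. The congruence rules
    make \<open>P \<subseteq> clopen_upsets X r\<close> and the quantifier bounds available while
    the later conjuncts are rewritten.\<close>
  ultimately show ?thesis
    unfolding prime_filters_def mem_Collect_eq
    by (simp add: join_upset_algebra cong: conj_cong ball_cong)
qed

lemma epsilon_in_prime_filters:
  assumes "x \<in> topspace X"
  shows "epsilon X r x \<in> prime_filters (upset_algebra X r \<eta>\<^sub>1 \<eta>\<^sub>2)"
  using assms empty_in_clopen_upsets topspace_in_clopen_upsets
  unfolding prime_filters_upset_algebra_iff epsilon_def
  by (auto simp: upset_algebra_Int_Un)

lemma epsilon_subset_iff:
  assumes "x \<in> topspace X" "y \<in> topspace X"
  shows "epsilon X r x \<subseteq> epsilon X r y \<longleftrightarrow> (x, y) \<in> r"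
  using separation[OF assms] by (auto simp: epsilon_def clopen_upsets_def)

lemma inj_on_epsilon: "inj_on (epsilon X r) (topspace X)"
  using antisym_order by (intro inj_onI) (metis antisymD epsilon_subset_iff subset_refl)

lemma prime_filter_is_epsilon:
  assumes "P \<in> prime_filters (upset_algebra X r \<eta>\<^sub>1 \<eta>\<^sub>2)"
  shows "\<exists>x \<in> topspace X. P = epsilon X r x"
proof (rule ccontr)
  assume none: "\<not> ?thesis"
  have sub: "P \<subseteq> clopen_upsets X r" and up: "\<And>U V. \<lbrakk>U \<in> P; V \<in> clopen_upsets X r; U \<subseteq> V\<rbrakk> \<Longrightarrow> V \<in> P"
    and Int: "\<And>U V. \<lbrakk>U \<in> P; V \<in> P\<rbrakk> \<Longrightarrow> U \<inter> V \<in> P"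
    and prime: "\<And>U V. \<lbrakk>U \<in> clopen_upsets X r; V \<in> clopen_upsets X r; U \<union> V \<in> P\<rbrakk> \<Longrightarrow> U \<in> P \<or> V \<in> P"
    and proper: "P \<noteq> {}" "P \<noteq> clopen_upsets X r"
    using assms unfolding prime_filters_upset_algebra_iff by blast+
  have top: "topspace X \<in> P"
    using proper(1) sub up topspace_in_clopen_upsets clopen_upsets_subset by blast
  have bot: "{} \<notin> P"
    using proper(2) sub up by blast
  \<comment> \<open>Inside \<open>W\<close>, some member of \<open>P\<close> is contained in a
    clopen up-set outside \<open>P\<close>. This covers both kinds of sets in the cover: the
    complement of a member of \<open>P\<close> takes \<open>V = {}\<close>, and a clopen up-set
    outside \<open>P\<close> takes \<open>U = topspace X\<close>.\<close>
  define Q where "Q W \<longleftrightarrow> (\<exists>U \<in> P. \<exists>V \<in> clopen_upsets X r - P. W \<inter> U \<subseteq> V)" for W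
  have "Q {}"
    using top bot empty_in_clopen_upsets by (auto simp: Q_def)
  moreover have "Q (W \<union> W')" if W: "Q W" "Q W'" for W W'
  proof -
    obtain U V U' V' where *: "U \<in> P" "V \<in> clopen_upsets X r - P" "W \<inter> U \<subseteq> V"
      "U' \<in> P" "V' \<in> clopen_upsets X r - P" "W' \<inter> U' \<subseteq> V'"
      using W unfolding Q_def by blast
    \<comment> \<open>Filters are closed under meets, and primality keeps the union outside
      \<open>P\<close>.\<close>
    then have "U \<inter> U' \<in> P" "V \<union> V' \<in> clopen_upsets X r - P"
      using Int prime upset_algebra_Int_Un(2) by blast+
    moreover have "(W \<union> W') \<inter> (U \<inter> U') \<subseteq> V \<union> V'"
      using * by blast
    ultimately show ?thesis
      unfolding Q_def by blast
  qed
  moreover have "\<exists>W. openin X W \<and> x \<in> W \<and> Q W" if x: "x \<in> topspace X" for x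
  proof -
    have "P \<noteq> epsilon X r x"
      using none x by blast
    then consider U where "U \<in> P" "x \<notin> U" | V where "V \<in> clopen_upsets X r - P" "x \<in> V"
      using sub unfolding epsilon_def by blast
    then show ?thesis
    proof cases
      case 1
      then have "openin X (topspace X - U)" "x \<in> topspace X - U"
        using sub x by (auto simp: clopen_upsets_def)
      moreover have "Q (topspace X - U)"
        using 1 bot empty_in_clopen_upsets unfolding Q_def by blast
      ultimately show ?thesis
        by blast
    next
      case 2
      then have "openin X V"
        by (simp add: clopen_upsets_def)
      moreover have "Q V"
        using 2 top unfolding Q_def by blast
      ultimately show ?thesis
        using 2 by blast
    qed
  qed
  ultimately obtain W where "topspace X \<subseteq> W" "Q W"
    using compactin_open_cover_directed[of X "topspace X" Q] compact
    unfolding compact_space_def by blast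
  \<comment> \<open>Since \<open>U \<subseteq> topspace X \<subseteq> W\<close>, intersecting with
    \<open>W\<close> leaves \<open>U\<close> unchanged.\<close>
  then obtain U V where "U \<in> P" "V \<in> clopen_upsets X r - P" "U \<subseteq> V"
    unfolding Q_def using sub clopen_upsets_subset by blast
  then show False
    using up by blast
qed

lemma epsilon_image_topspace:
  "epsilon X r ` topspace X = prime_filters (upset_algebra X r \<eta>\<^sub>1 \<eta>\<^sub>2)"
  using epsilon_in_prime_filters prime_filter_is_epsilon by blast

text \<open>Every prime filter is the image of a point \<open>x\<close>, and that image contains
  \<open>U\<close> exactly when \<open>x \<in> U\<close>. The neighbourhood functions are compared
  through this equation.\<close>

lemma stone_map_eq_epsilon_image:
  assumes "U \<in> clopen_upsets X r"
  shows "stone_map (upset_algebra X r \<eta>\<^sub>1 \<eta>\<^sub>2) U = epsilon X r ` U"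
  using assms clopen_upsets_subset[OF assms]
  unfolding stone_map_def epsilon_image_topspace[symmetric] by (auto simp: epsilon_def)

section \<open>Topology and order of the dual space\<close>

lemma homeomorphic_map_epsilon:
  "homeomorphic_map X (dual_topology (upset_algebra X r \<eta>\<^sub>1 \<eta>\<^sub>2)) (epsilon X r)"
proof -
  let ?H = "upset_algebra X r \<eta>\<^sub>1 \<eta>\<^sub>2"
  have carrier: "carrier ?H = clopen_upsets X r"
    by (simp add: upset_algebra_def)
  then have ne: "carrier ?H \<noteq> {}"
    using empty_in_clopen_upsets by blast
  have "continuous_map X (dual_topology ?H) (epsilon X r)"
    unfolding dual_topology_def
  \<comment> \<open>Only subbasic sets need open preimages, and these preimages are \<open>U\<close>
    and its complement. The second goal asks that the image lie in the union of the subbasis, which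
    is the whole dual space.\<close>
  proof (rule continuous_on_generated_topo)
    fix S assume "S \<in> stone_map ?H ` carrier ?H \<union> (\<lambda>a. prime_filters ?H - stone_map ?H a) ` carrier ?H"
    then obtain U where U: "U \<in> clopen_upsets X r"
      and S: "S = stone_map ?H U \<or> S = prime_filters ?H - stone_map ?H U"
      by (auto simp: carrier)
    have "epsilon X r -` stone_map ?H U \<inter> topspace X = U"
      "epsilon X r -` (prime_filters ?H - stone_map ?H U) \<inter> topspace X = topspace X - U"
      using U clopen_upsets_subset[OF U] epsilon_in_prime_filters
      by (auto simp: stone_map_def epsilon_def)
    then show "openin X (epsilon X r -` S \<inter> topspace X)"
      using U S by (auto simp: clopen_upsets_def openin_diff)
  next
    have "prime_filters ?H = topspace (dual_topology ?H)"
      by (simp add: topspace_dual_topology[OF ne])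
    then show "epsilon X r ` topspace X \<subseteq>
        \<Union>(stone_map ?H ` carrier ?H \<union> (\<lambda>a. prime_filters ?H - stone_map ?H a) ` carrier ?H)"
      using epsilon_in_prime_filters
      unfolding dual_topology_def topology_generated_by_topspace image_subset_iff by metis
  qed
  then show ?thesis
    using compact Hausdorff_dual_topology[OF ne] inj_on_epsilon
    by (intro continuous_imp_homeomorphic_map)
      (simp_all add: topspace_dual_topology[OF ne] epsilon_image_topspace)
qed

lemma dual_order_epsilon_iff:
  assumes "x \<in> topspace X" "y \<in> topspace X"
  shows "(epsilon X r x, epsilon X r y) \<in> dual_order (upset_algebra X r \<eta>\<^sub>1 \<eta>\<^sub>2) \<longleftrightarrow> (x, y) \<in> r"
  using assms by (simp add: dual_order_def epsilon_in_prime_filters epsilon_subset_iff)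

text \<open>A homeomorphism that is also an order isomorphism transports clopen down-sets in both
  directions. This identifies the set from which \<open>dual_eta_diamond\<close> subtracts.\<close>

lemma clopen_downsets_dual:
  "clopen_downsets (dual_topology (upset_algebra X r \<eta>\<^sub>1 \<eta>\<^sub>2)) (dual_order (upset_algebra X r \<eta>\<^sub>1 \<eta>\<^sub>2))
    = (`) (epsilon X r) ` clopen_downsets X r"
  (is "?L = ?R")
proof -
  let ?H = "upset_algebra X r \<eta>\<^sub>1 \<eta>\<^sub>2"
  let ?\<epsilon> = "epsilon X r"
  note hom = homeomorphic_map_epsilon[of \<eta>\<^sub>1 \<eta>\<^sub>2]
  have iff: "?\<epsilon> ` D \<in> ?L \<longleftrightarrow> D \<in> clopen_downsets X r" if D: "D \<subseteq> topspace X" for D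
  proof -
    have "(dual_order ?H)\<inverse> `` (?\<epsilon> ` D) = ?\<epsilon> ` (r\<inverse> `` D)"
    proof -
      have "P \<in> (dual_order ?H)\<inverse> `` (?\<epsilon> ` D) \<longleftrightarrow> P \<in> ?\<epsilon> ` (r\<inverse> `` D)" for P
      \<comment> \<open>The dual order relates prime filters only, and all of them are images of
        points; for any other \<open>P\<close> both sides are false.\<close>
      proof (cases "P \<in> ?\<epsilon> ` topspace X")
        case True
        then obtain x where x: "x \<in> topspace X" "P = ?\<epsilon> x"
          by blast
        have "r\<inverse> `` D \<subseteq> topspace X"
          using order_subset by blast
        then have "P \<in> ?\<epsilon> ` (r\<inverse> `` D) \<longleftrightarrow> x \<in> r\<inverse> `` D"
          using x inj_on_image_mem_iff[OF inj_on_epsilon] by simp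
        also have "\<dots> \<longleftrightarrow> (\<exists>y \<in> D. (?\<epsilon> x, ?\<epsilon> y) \<in> dual_order ?H)"
          using x D by (auto simp: dual_order_epsilon_iff subset_iff)
        finally show ?thesis
          using x by auto
      next
        case False
        moreover have "P \<in> ?\<epsilon> ` topspace X" if "(P, Q) \<in> dual_order ?H" for Q
          using that by (simp add: dual_order_def epsilon_image_topspace[of \<eta>\<^sub>1 \<eta>\<^sub>2])
        ultimately show ?thesis
          using order_subset by blast
      qed
      then show ?thesis
        by blast
    qed
    \<comment> \<open>Writing an inclusion \<open>A \<subseteq> D\<close> as
      \<open>A \<union> D = D\<close> reduces the claim to injectivity on images of sets.\<close>
    moreover have "?\<epsilon> ` (r\<inverse> `` D) \<subseteq> ?\<epsilon> ` D \<longleftrightarrow> r\<inverse> `` D \<subseteq> D"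
    proof -
      have "r\<inverse> `` D \<union> D \<subseteq> topspace X"
        using D order_subset by blast
      then show ?thesis
        using D inj_on_image_eq_iff[OF inj_on_epsilon, of "r\<inverse> `` D \<union> D" D]
        by (simp only: image_Un subset_Un_eq)
    qed
    ultimately show ?thesis
      using homeomorphic_map_openness[OF hom D] homeomorphic_map_closedness[OF hom D]
      by (simp add: clopen_downsets_def)
  qed
  show ?thesis
  proof (intro equalityI subsetI)
    fix E assume E: "E \<in> ?L"
    then have "E \<subseteq> ?\<epsilon> ` topspace X"
      using openin_subset homeomorphic_imp_surjective_map[OF hom]
      by (fastforce simp: clopen_downsets_def)
    then obtain D where "D \<subseteq> topspace X" "E = ?\<epsilon> ` D"
      by (auto simp: subset_image_iff)
    then show "E \<in> ?R"
      using E iff by blast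
  next
    fix E assume "E \<in> ?R"
    then obtain D where "D \<in> clopen_downsets X r" "E = ?\<epsilon> ` D"
      by blast
    then show "E \<in> ?L"
      using iff[of D] openin_subset[of X D] by (simp add: clopen_downsets_def)
  qed
qed

end

section \<open>Transport of the neighbourhood functions\<close>

context modal_esakia_space
begin

text \<open>The box of \<open>U\<close> is itself a clopen up-set, so it belongs to the filter of
  \<open>x\<close> exactly when it contains \<open>x\<close>, that is, when
  \<open>U \<in> \<eta>\<^sub>1 x\<close>.\<close>

lemma dual_eta_box_epsilon:
  assumes "x \<in> topspace X"
  shows "dual_eta_box (upset_algebra X r \<eta>\<^sub>1 \<eta>\<^sub>2) (epsilon X r x) = (`) (epsilon X r) ` \<eta>\<^sub>1 x"
proof -
  let ?H = "upset_algebra X r \<eta>\<^sub>1 \<eta>\<^sub>2"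
  have "U \<in> clopen_upsets X r \<and> box_of X \<eta>\<^sub>1 U \<in> epsilon X r x \<longleftrightarrow> U \<in> \<eta>\<^sub>1 x" for U
    using assms eta1_subset[OF assms] box_closed by (auto simp: epsilon_def box_of_def)
  then have "dual_eta_box ?H (epsilon X r x) = stone_map ?H ` \<eta>\<^sub>1 x"
    by (auto simp: dual_eta_box_def upset_algebra_def)
  also have "\<dots> = (`) (epsilon X r) ` \<eta>\<^sub>1 x"
    using eta1_subset[OF assms] by (intro image_cong) (auto simp: stone_map_eq_epsilon_image)
  finally show ?thesis .
qed

text \<open>The diamond of \<open>U\<close> lies in the filter of \<open>x\<close> exactly when the
  complement of \<open>U\<close> is not in \<open>\<eta>\<^sub>2 x\<close>. Hence the subtracted
  sets are the images of the clopen down-sets outside \<open>\<eta>\<^sub>2 x\<close>, and a double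
  relative complement recovers \<open>\<eta>\<^sub>2 x\<close>.\<close>

lemma dual_eta_diamond_epsilon:
  assumes x: "x \<in> topspace X"
  shows "dual_eta_diamond (upset_algebra X r \<eta>\<^sub>1 \<eta>\<^sub>2) (epsilon X r x) = (`) (epsilon X r) ` \<eta>\<^sub>2 x"
proof -
  let ?H = "upset_algebra X r \<eta>\<^sub>1 \<eta>\<^sub>2"
  let ?\<epsilon> = "epsilon X r"
  have compl: "prime_filters ?H - stone_map ?H U = ?\<epsilon> ` (topspace X - U)"
    if "U \<in> clopen_upsets X r" for U
    using clopen_upsets_subset[OF that] inj_on_epsilon
    unfolding stone_map_eq_epsilon_image[OF that] epsilon_image_topspace[symmetric]
    by (simp add: inj_on_image_set_diff)
  have dia: "diamond_of X \<eta>\<^sub>2 U \<in> ?\<epsilon> x \<longleftrightarrow> topspace X - U \<notin> \<eta>\<^sub>2 x"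
    if "U \<in> clopen_upsets X r" for U
    using x diamond_closed[OF that] by (auto simp: epsilon_def diamond_of_def)
  have "{prime_filters ?H - stone_map ?H U | U. U \<in> carrier ?H \<and> Diamond ?H U \<in> ?\<epsilon> x}
    = {?\<epsilon> ` (topspace X - U) | U. U \<in> clopen_upsets X r \<and> topspace X - U \<notin> \<eta>\<^sub>2 x}"
  proof -
    have "carrier ?H = clopen_upsets X r" "Diamond ?H = diamond_of X \<eta>\<^sub>2"
      by (simp_all add: upset_algebra_def)
    then show ?thesis
      using compl dia by (simp add: set_eq_iff) metis
  qed
  also have "\<dots> = (`) ?\<epsilon> ` {topspace X - U | U. U \<in> clopen_upsets X r \<and> topspace X - U \<notin> \<eta>\<^sub>2 x}"
    by blast
  also have "{topspace X - U | U. U \<in> clopen_upsets X r \<and> topspace X - U \<notin> \<eta>\<^sub>2 x}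
      = clopen_downsets X r - \<eta>\<^sub>2 x"
    by (auto simp: clopen_downsets_iff)
  finally have "dual_eta_diamond ?H (?\<epsilon> x)
      = (`) ?\<epsilon> ` clopen_downsets X r - (`) ?\<epsilon> ` (clopen_downsets X r - \<eta>\<^sub>2 x)"
    by (simp add: dual_eta_diamond_def clopen_downsets_dual)
  \<comment> \<open>Taking images commutes with this difference because the direct-image map is
    injective on subsets of the space.\<close>
  also have "\<dots> = (`) ?\<epsilon> ` (clopen_downsets X r - (clopen_downsets X r - \<eta>\<^sub>2 x))"
  proof (rule inj_on_image_set_diff[symmetric])
    show "inj_on ((`) ?\<epsilon>) (Pow (topspace X))"
      using inj_on_epsilon by (rule inj_on_image_Pow)
  qed (auto simp: clopen_downsets_iff)
  also have "clopen_downsets X r - (clopen_downsets X r - \<eta>\<^sub>2 x) = \<eta>\<^sub>2 x"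
    using eta2_subset[OF x] by blast
  finally show ?thesis .
qed

lemma me_homeomorphism_epsilon:
  "me_homeomorphism X r \<eta>\<^sub>1 \<eta>\<^sub>2 (dual_topology (upset_algebra X r \<eta>\<^sub>1 \<eta>\<^sub>2))
    (dual_order (upset_algebra X r \<eta>\<^sub>1 \<eta>\<^sub>2)) (dual_eta_box (upset_algebra X r \<eta>\<^sub>1 \<eta>\<^sub>2))
    (dual_eta_diamond (upset_algebra X r \<eta>\<^sub>1 \<eta>\<^sub>2)) (epsilon X r)"
  unfolding me_homeomorphism_def
  using homeomorphic_map_epsilon dual_order_epsilon_iff
  by (auto simp: dual_eta_box_epsilon dual_eta_diamond_epsilon)

end

section \<open>Closed sets of maximal elements\<close>

lemma (in esakia_space) separation_closed_maximal:
  assumes "closedin X C" "C \<subseteq> max_elements X r" "x \<in> topspace X - C"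
  shows "\<exists>U \<in> clopen_upsets X r. C \<subseteq> U \<and> x \<notin> U"
proof -
  define Q where "Q W \<longleftrightarrow> W \<in> clopen_upsets X r \<and> x \<notin> W" for W
  have "compactin X C"
    using assms(1) compact by (rule closedin_compact_space[rotated])
  moreover have "\<exists>W. openin X W \<and> c \<in> W \<and> Q W" if "c \<in> C" for c
  proof -
    \<comment> \<open>If \<open>c\<close> were below \<open>x\<close>, maximality of
      \<open>c\<close> would give \<open>x = c\<close>, contradicting
      \<open>x \<notin> C\<close>.\<close>
    have "c \<in> topspace X" "(c, x) \<notin> r"
      using that assms(2,3) by (auto simp: max_elements_def)
    then obtain U where "U \<in> clopen_upsets X r" "c \<in> U" "x \<notin> U"
      using separation[of c x] assms(3) by blast
    then show ?thesis
      by (intro exI[of _ U]) (simp add: Q_def clopen_upsets_def)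
  qed
  ultimately have "\<exists>W. C \<subseteq> W \<and> Q W"
    by (rule compactin_open_cover_directed[where Q = Q])
      (auto simp: Q_def empty_in_clopen_upsets upset_algebra_Int_Un)
  then show ?thesis
    by (auto simp: Q_def)
qed

text \<open>A point of \<open>C\<close> lies in every clopen up-set that includes \<open>C\<close>,
  while a point outside \<open>C\<close> is missed by one of them. As all prime filters come from
  points, those containing the filter of \<open>C\<close> come exactly from
  \<open>C\<close>.\<close>

lemma (in esakia_space) epsilon_image_closed_maximal:
  assumes "closedin X C" "C \<subseteq> max_elements X r"
  shows "epsilon X r ` C
    = closed_of_filter (upset_algebra X r \<eta>\<^sub>1 \<eta>\<^sub>2) (filter_of_closed X r C)"
proof -
  have "C \<subseteq> topspace X"
    using assms(1) by (rule closedin_subset)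
  moreover have "filter_of_closed X r C \<subseteq> epsilon X r x \<longleftrightarrow> x \<in> C" if "x \<in> topspace X" for x
    using separation_closed_maximal[OF assms, of x] that
    by (auto simp: filter_of_closed_def epsilon_def)
  ultimately show ?thesis
    unfolding closed_of_filter_def epsilon_image_topspace[symmetric] by blast
qed

theorem theorem22:
  fixes X :: "'a topology" and r :: "'a rel" and \<eta>\<^sub>1 \<eta>\<^sub>2 :: "'a \<Rightarrow> 'a set set" and C :: "'a set"
  assumes "mne_space X r \<eta>\<^sub>1 \<eta>\<^sub>2 C"
  shows "let H = upset_algebra X r \<eta>\<^sub>1 \<eta>\<^sub>2 in
    epsilon X r ` topspace X \<subseteq> prime_filters H
    \<and> me_homeomorphism X r \<eta>\<^sub>1 \<eta>\<^sub>2
        (dual_topology H) (dual_order H) (dual_eta_box H) (dual_eta_diamond H) (epsilon X r)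
    \<and> epsilon X r ` C = closed_of_filter H (filter_of_closed X r C)"
proof -
  interpret mne_space X r \<eta>\<^sub>1 \<eta>\<^sub>2 C
    by fact
  show ?thesis
    using me_homeomorphism_epsilon C_closed C_max
    by (simp add: Let_def image_subset_iff epsilon_in_prime_filters epsilon_image_closed_maximal)
qed

end
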